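(* Suppose $n\geq 0$. \begin{enumerate} \item If $a$ is a binary sequence of length $n$, then $\mathcal{P}_a$ is a $2$-chain. \item If $P$ is an $(n+2)$-element $2$-chain, then $P\cong\mathcal{P}_a$ for some binary sequence $a$. \item If $a,b$ are binary sequences with $\mathcal{P}_a\cong\mathcal{P}_b$, then $b=a$ or $b=\bar a$. \end{enumerate}
   Context: All posets are finite; a partial order is written $\preceq$, with $p\prec q$ meaning $p\preceq q$ and $p\neq q$. A poset $(P,\preceq)$ is a $2$-chain if (1) there is a unique way to write $P$ as the (set) union of two chains, and (2) $\preceq$ is maximal subject to (1), i.e. for every proper refinement $\preceq^+$ of $\preceq$ there is more than one way to write $P$ as the union of two $\preceq^+$-chains. For a binary sequence $a=a_1\dots a_n$ (word in $\{0,1\}$), $\bar a$ is obtained by swapping $0$ and $1$ in every entry. Define sequences of length $n+1$: $a(0)=1a_1\dots a_n$, $a(i)=a_1\dots a_{i-1}\,0\,1\,a_{i+1}\dots a_n$ for $1\leq i\leq n$, and $a(n+1)=a_1\dots a_n0$. Two binary sequences $b,c$ of the same length are opposed if $b_i>c_i$ and $b_j<c_j$ for some $i,j$. $\mathcal{P}_a=\{a(0),\dots,a(n+1)\}$ with $a(i)\prec a(j)$ whenever $i<j$ and $a(i),a(j)$ are opposed; this is a partial order. *)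

theory Defs
  imports Main
begin

text \<open>
  A poset is a carrier set \<open>P\<close> together with its non-strict order relation \<open>r\<close>
  on \<open>P\<close> (\<^const>\<open>partial_order_on\<close>).
\<close>

text \<open>
  A way to write \<open>P\<close> as the union of two chains is an unordered pair of chains, not
  required to be disjoint or nonempty.
\<close>

definition two_chain_covers :: "'a set \<Rightarrow> 'a rel \<Rightarrow> 'a set set set" where
  "two_chain_covers P r = {{A, B} | A B. A \<in> Chains r \<and> B \<in> Chains r \<and> A \<union> B = P}"

definition two_chain :: "'a set \<Rightarrow> 'a rel \<Rightarrow> bool" where
  "two_chain P r \<longleftrightarrow>
     finite P \<and> partial_order_on P r \<and>
     (\<exists>!C. C \<in> two_chain_covers P r) \<and>
     (\<forall>s. partial_order_on P s \<and> r \<subset> s \<longrightarrow>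
        (\<exists>C D. C \<in> two_chain_covers P s \<and> D \<in> two_chain_covers P s \<and> C \<noteq> D))"

definition poset_isomorphic :: "'a set \<Rightarrow> 'a rel \<Rightarrow> 'b set \<Rightarrow> 'b rel \<Rightarrow> bool" where
  "poset_isomorphic P r Q s \<longleftrightarrow>
     (\<exists>f. bij_betw f P Q \<and> (\<forall>x\<in>P. \<forall>y\<in>P. (x, y) \<in> r \<longleftrightarrow> (f x, f y) \<in> s))"

text \<open>
  Binary sequences are lists of booleans, \<open>False\<close> being \<open>0\<close> and \<open>True\<close> being \<open>1\<close>
  (so \<open>False < True\<close> in the order on \<^typ>\<open>bool\<close>).  Lists are indexed from \<open>0\<close>:
  the entry \<open>a\<^sub>i\<close> of the mathematical notation is \<open>a ! (i - 1)\<close>.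
\<close>

definition bar :: "bool list \<Rightarrow> bool list" where
  "bar a = map Not a"

text \<open>The sequence \<open>a(i)\<close>, meaningful for \<open>i \<le> length a + 1\<close>.\<close>

definition seq_at :: "bool list \<Rightarrow> nat \<Rightarrow> bool list" where
  "seq_at a i =
     (if i = 0 then True # a
      else if i \<le> length a then take (i - 1) a @ [False, True] @ drop i a
      else a @ [False])"

definition opposed :: "bool list \<Rightarrow> bool list \<Rightarrow> bool" where
  "opposed b c \<longleftrightarrow> length b = length c \<and>
     (\<exists>i<length b. b ! i > c ! i) \<and> (\<exists>j<length b. b ! j < c ! j)"

definition pset :: "bool list \<Rightarrow> bool list set" where
  "pset a = seq_at a ` {0..length a + 1}"

definition pord :: "bool list \<Rightarrow> bool list rel" where
  "pord a = {(x, y). x \<in> pset a \<and> y \<in> pset a \<and>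
     (x = y \<or> (\<exists>i j. i < j \<and> j \<le> length a + 1 \<and>
        x = seq_at a i \<and> y = seq_at a j \<and> opposed x y))}"

end

theory Submission
  imports Defs
begin

text \<open>
  Extend \<open>a\<close> to the word \<open>0a1\<close>, indexed by \<open>0, \<dots>, n + 1\<close>.  For \<open>i < j\<close> the elements \<open>a(i)\<close>, \<open>a(j)\<close> are
  incomparable iff the factor from \<open>i\<close> to \<open>j\<close> has the form \<open>0 1\<dots>1 0\<dots>0 1\<close>; these pairs are the edges
  of a tree (a caterpillar) whose two colour classes are the zeros and the ones.  A poset that is a union of
  two chains in exactly one way is one whose incomparability graph cannot be cut into two parts, so the
  tree property gives the first claim.

  For the second, list a 2-chain \<open>P = A \<union> B\<close> by its linear extension that puts \<open>A\<close> before \<open>B\<close> whenever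
  there is a choice, and record membership in \<open>B\<close> as a word \<open>0a1\<close>.  Each initial segment of the list is
  crossed by an incomparable pair, which forces all edges of \<open>\<P>\<^sub>a\<close> to be incomparable in \<open>P\<close>; hence \<open>\<P>\<^sub>a\<close>
  refines \<open>P\<close>, and maximality gives equality.

  For the third, the numbers of elements strictly below the members of either chain, other than 0, are the
  positions of the zeros of \<open>a\<close> for one chain and of the ones for the other.  So the poset determines
  \<open>a\<close> up to exchanging the two symbols.
\<close>

definition edge :: "(nat \<Rightarrow> bool) \<Rightarrow> nat \<Rightarrow> nat \<Rightarrow> bool" where
  "edge w i j \<longleftrightarrow> i < j \<and> \<not> w i \<and> w j \<and> \<not> (\<exists>k l. i < k \<and> k < l \<and> l < j \<and> \<not> w k \<and> w l)"

text \<open>The word \<open>0a1\<close>; beyond its end the value is junk (true).\<close>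

definition word :: "bool list \<Rightarrow> nat \<Rightarrow> bool" where
  "word a k \<longleftrightarrow> k \<noteq> 0 \<and> (k \<le> length a \<longrightarrow> a ! (k - 1))"

definition down :: "'a set \<Rightarrow> 'a rel \<Rightarrow> 'a \<Rightarrow> nat" where
  "down P r x = card {y \<in> P. y \<noteq> x \<and> (y, x) \<in> r}"

section \<open>Producing a second cover by two chains\<close>

lemma two_covers_if_overlap:
  assumes "A \<in> Chains r" "B \<in> Chains r" "A \<union> B = P" "A \<inter> B \<noteq> {}"
  shows "\<exists>C D. C \<in> two_chain_covers P r \<and> D \<in> two_chain_covers P r \<and> C \<noteq> D"
proof -
  obtain x where x: "x \<in> A" "x \<in> B" using assms(4) by blast
  have "A - {x} \<in> Chains r" "(A - {x}) \<union> B = P"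
    using assms x unfolding Chains_def by auto
  then have "{A - {x}, B} \<in> two_chain_covers P r" "{A, B} \<in> two_chain_covers P r"
    using assms unfolding two_chain_covers_def by blast+
  moreover have "{A - {x}, B} \<noteq> {A, B}"
    using x by (auto simp: doubleton_eq_iff)
  ultimately show ?thesis by (intro exI conjI)
qed

text \<open>Exchange the two chains outside \<open>S\<close>: comparability across the cut keeps
  both new sets chains. The points \<open>x\<close> and \<open>y\<close> make both sides nonempty,
  so for disjoint chains the pair really changes.\<close>

lemma two_covers_if_cut:
  assumes A: "A \<in> Chains r" and B: "B \<in> Chains r" and AB: "A \<union> B = P"
    and S: "x \<in> P" "x \<in> S" "y \<in> P" "y \<notin> S"
    and cut: "\<And>u v. u \<in> P \<Longrightarrow> v \<in> P \<Longrightarrow> u \<in> S \<Longrightarrow> v \<notin> S \<Longrightarrow> (u, v) \<in> r \<or> (v, u) \<in> r"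
  shows "\<exists>C D. C \<in> two_chain_covers P r \<and> D \<in> two_chain_covers P r \<and> C \<noteq> D"
proof (cases "A \<inter> B = {}")
  case False
  then show ?thesis using two_covers_if_overlap A B AB by blast
next
  case True
  let ?A = "(A \<inter> S) \<union> (B - S)" and ?B = "(B \<inter> S) \<union> (A - S)"
  have "?A \<in> Chains r" "?B \<in> Chains r"
    using A B AB cut unfolding Chains_def by blast+
  moreover have "?A \<union> ?B = P" using AB by blast
  ultimately have "{?A, ?B} \<in> two_chain_covers P r" "{A, B} \<in> two_chain_covers P r"
    using A B AB unfolding two_chain_covers_def by blast+
  moreover have "?A \<noteq> A" "?A \<noteq> B" using True S AB by blast+
  then have "{?A, ?B} \<noteq> {A, B}" by (metis doubleton_eq_iff)
  ultimately show ?thesis by (intro exI conjI)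
qed

section \<open>Edges of a word\<close>

lemma edge_no_ascent:
  assumes "edge w i j" "i < k" "k < l" "l < j" "\<not> w k"
  shows "\<not> w l"
  using assms unfolding edge_def by blast

text \<open>A part of a factor without inner ascent has none either, so the letter at
  \<open>j\<close> decides which half is an edge. Contraposed, this is transitivity of the order in
  \<open>word_poset\<close>.\<close>

lemma edge_split:
  assumes "edge w i k" "i < j" "j < k"
  shows "edge w i j \<or> edge w j k"
proof (cases "w j")
  case True
  then show ?thesis using assms unfolding edge_def by (meson order.strict_trans)
next
  case False
  then show ?thesis using assms unfolding edge_def by (meson order.strict_trans)
qed

text \<open>The interior of the factor is \<open>1...1 0...0\<close>. Cutting between the two blocks
  makes every zero-one pair across the cut enclose the edge.\<close>

lemma edge_cut:
  assumes e: "edge w i j"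
  obtains m where "i \<le> m" "m < j" "\<And>k. k \<le> m \<Longrightarrow> \<not> w k \<Longrightarrow> k \<le> i"
    "\<And>l. m < l \<Longrightarrow> w l \<Longrightarrow> j \<le> l"
proof -
  \<comment> \<open>The end of the block of ones: the first zero after \<open>i\<close>, or
    \<open>j\<close> if no zero comes before it.\<close>
  define M where "M = (LEAST k. i < k \<and> (\<not> w k \<or> k = j))"
  have j: "i < j \<and> (\<not> w j \<or> j = j)" using e by (simp add: edge_def)
  have M: "i < M" "\<not> w M \<or> M = j" "M \<le> j"
    unfolding M_def using LeastI[of "\<lambda>k. i < k \<and> (\<not> w k \<or> k = j)", OF j]
      Least_le[of "\<lambda>k. i < k \<and> (\<not> w k \<or> k = j)", OF j] by auto
  have before: "w k" if "i < k" "k < M" for k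
    using not_less_Least[of k "\<lambda>k. i < k \<and> (\<not> w k \<or> k = j)"] that by (auto simp: M_def)
  show ?thesis
  proof (rule that[of "M - 1"])
    show "i \<le> M - 1" "M - 1 < j" using M by auto
    show "k \<le> i" if "k \<le> M - 1" "\<not> w k" for k
    proof -
      have "k < M" using that M by simp
      then show ?thesis using before[of k] that by (meson not_le)
    qed
    show "j \<le> l" if "M - 1 < l" "w l" for l
    proof (rule ccontr)
      assume "\<not> j \<le> l"
      then have l: "l < j" "M \<le> l" using that by auto
      then have "M < l" "\<not> w M" using M that by (auto simp: le_less)
      then show False using edge_no_ascent[OF e M(1) _ l(1)] that by blast
    qed
  qed
qed

text \<open>Deleting the edge disconnects the graph: \<open>S\<close> is a union of components of what is left.\<close>

lemma edge_bridge:
  assumes e: "edge w i j"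
  obtains S where "i \<in> S \<longleftrightarrow> j \<notin> S"
    "\<And>k l. edge w k l \<Longrightarrow> (k \<in> S \<longleftrightarrow> l \<notin> S) \<Longrightarrow> k = i \<and> l = j"
proof (cases "w (i + 1)")
  \<comment> \<open>Factor \<open>00...01\<close>: \<open>i\<close> is a leaf, since with a second
    edge from \<open>i\<close> the longer of the two would contain an ascent starting at
    \<open>i + 1\<close>.\<close>
  case False
  have ij: "i < j" "\<not> w i" "w j" using e by (auto simp: edge_def)
  with False have "i + 1 < j" by (metis Suc_eq_plus1 Suc_lessI)
  have "l = j" if l: "edge w i l" for l
  proof -
    have "w l" "i < l" "i + 1 \<noteq> l" using l False by (auto simp: edge_def)
    then have "\<not> l < j" "\<not> j < l"
      using edge_no_ascent[OF e, of "i + 1" l] edge_no_ascent[OF l, of "i + 1" j] False ij \<open>i + 1 < j\<close>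
      by auto
    then show ?thesis by simp
  qed
  moreover have "\<not> edge w l i" for l using ij by (auto simp: edge_def)
  ultimately show ?thesis using that[of "{i}"] ij(1) by auto
next
  case w1: True
  have ij: "i < j" "\<not> w i" "w j" using e by (auto simp: edge_def)
  show ?thesis
  proof (cases "j = i + 1")
    \<comment> \<open>Factor \<open>01\<close>: no edge passes over both letters, so deleting this
      edge leaves \<open>j\<close> with the part left of \<open>i\<close>, and \<open>i\<close> with
      the part right of \<open>j\<close>.\<close>
    case True
    show ?thesis
    proof (rule that[of "{..<i} \<union> {i + 1}"])
      show "i \<in> {..<i} \<union> {i + 1} \<longleftrightarrow> j \<notin> {..<i} \<union> {i + 1}" using True by simp
      fix k l assume kl: "edge w k l" "k \<in> {..<i} \<union> {i + 1} \<longleftrightarrow> l \<notin> {..<i} \<union> {i + 1}"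
      have "\<not> (k < i \<and> i + 1 < l)" using edge_no_ascent[OF kl(1), of i "i + 1"] ij w1 by auto
      moreover have "k \<noteq> i + 1" "l \<noteq> i" "k < l" using kl(1) ij w1 by (auto simp: edge_def)
      ultimately show "k = i \<and> l = j" using kl(2) True by auto
    qed
  next
    case False
    with ij have ij1: "i + 1 < j" by simp
    show ?thesis
    proof (cases "w (j - 1)")
      \<comment> \<open>Factor \<open>01...1\<close>: \<open>j\<close> is a leaf.\<close>
      case True
      have "k = i" if "edge w k j" for k
      proof (rule ccontr)
        assume "k \<noteq> i"
        then consider "k < i" | "i < k" by linarith
        then show False
        proof cases
          case 1
          then show False using edge_no_ascent[OF that, of i "i + 1"] ij w1 ij1 by simp
        next
          case 2
          have "k \<noteq> j - 1" "k < j" using that True by (auto simp: edge_def)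
          then show False
            using 2 edge_no_ascent[OF e, of k "j - 1"] that True ij1 by (auto simp: edge_def)
        qed
      qed
      moreover have "\<not> edge w j l" for l using ij by (auto simp: edge_def)
      ultimately show ?thesis using that[of "{j}"] ij(1) by auto
    next
      \<comment> \<open>Factor \<open>01...10...01\<close> with both blocks nonempty: an edge over
        the cut encloses this one, and if larger it would contain the ascent at \<open>i\<close>,
        \<open>i + 1\<close> or at \<open>j - 1\<close>, \<open>j\<close>.\<close>
      case wj: False
      have ex: "i < j - 1 \<and> \<not> w (j - 1)" using wj ij1 by auto
      obtain m where m: "i \<le> m" "m < j" "\<And>k. k \<le> m \<Longrightarrow> \<not> w k \<Longrightarrow> k \<le> i"
        "\<And>l. m < l \<Longrightarrow> w l \<Longrightarrow> j \<le> l"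
        using edge_cut[OF e] by blast
      show ?thesis
      proof (rule that[of "{..m}"])
        show "i \<in> {..m} \<longleftrightarrow> j \<notin> {..m}" using m by auto
        fix k l assume kl: "edge w k l" "k \<in> {..m} \<longleftrightarrow> l \<notin> {..m}"
        have "k < l" "\<not> w k" "w l" using kl by (auto simp: edge_def)
        then have "k \<le> i" "j \<le> l" using kl(2) m(3)[of k] m(4)[of l] by auto
        have "\<not> k < i" using edge_no_ascent[OF kl(1), of i "i + 1"] ij w1 ij1 \<open>j \<le> l\<close> by auto
        moreover have "\<not> j < l" using edge_no_ascent[OF kl(1), of "j - 1" j] ij ex \<open>k \<le> i\<close> by auto
        ultimately show "k = i \<and> l = j" using \<open>k \<le> i\<close> \<open>j \<le> l\<close> by simp
      qed
    qed
  qed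
qed

section \<open>Posets given by a word are 2-chains\<close>

text \<open>Carrier and listing are arbitrary because the locale serves both \<open>pset a\<close>
  and an abstract 2-chain.\<close>

locale word_poset =
  fixes w :: "nat \<Rightarrow> bool" and N :: nat and P :: "'a set" and r :: "'a rel" and g :: "nat \<Rightarrow> 'a"
  assumes w_0: "\<not> w 0" and w_N: "w N"
    and bij: "bij_betw g {..N} P"
    and r_subset: "r \<subseteq> P \<times> P"
    and rel: "i \<le> N \<Longrightarrow> j \<le> N \<Longrightarrow> (g i, g j) \<in> r \<longleftrightarrow> i = j \<or> i < j \<and> \<not> edge w i j"
begin

definition zeros :: "'a set" where "zeros = g ` {k. k \<le> N \<and> \<not> w k}"
definition ones :: "'a set" where "ones = g ` {k. k \<le> N \<and> w k}"

lemma P_eq: "P = g ` {..N}" using bij by (simp add: bij_betw_def)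

lemma g_eq: "i \<le> N \<Longrightarrow> j \<le> N \<Longrightarrow> g i = g j \<longleftrightarrow> i = j"
  using bij by (auto simp: bij_betw_def inj_on_def)

lemma g_in: "i \<le> N \<Longrightarrow> g i \<in> P" by (simp add: P_eq)

lemma partial_order: "partial_order_on P r"
proof -
  have "refl_on P r" by (auto simp: refl_on_def P_eq rel)
  moreover have "trans r"
  proof (rule transI)
    fix x y z assume xy: "(x, y) \<in> r" and yz: "(y, z) \<in> r"
    then obtain i j k where ijk: "i \<le> N" "j \<le> N" "k \<le> N" "x = g i" "y = g j" "z = g k"
      using r_subset P_eq by blast
    with xy yz have "i = j \<or> i < j \<and> \<not> edge w i j" "j = k \<or> j < k \<and> \<not> edge w j k"
      by (simp_all add: rel)
    then have "i = k \<or> i < k \<and> \<not> edge w i k" using edge_split by fastforce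
    with ijk show "(x, z) \<in> r" by (simp add: rel)
  qed
  moreover have "antisym r"
  proof (rule antisymI)
    fix x y assume xy: "(x, y) \<in> r" and yx: "(y, x) \<in> r"
    then obtain i j where ij: "i \<le> N" "j \<le> N" "x = g i" "y = g j"
      using r_subset P_eq by blast
    with xy yx show "x = y" by (auto simp: rel)
  qed
  ultimately show ?thesis
    using r_subset by (simp add: partial_order_on_def preorder_on_def)
qed

lemma zeros_chain: "zeros \<in> Chains r"
  by (auto simp: Chains_def zeros_def rel edge_def)

lemma ones_chain: "ones \<in> Chains r"
  by (auto simp: Chains_def ones_def rel edge_def)

lemma zeros_Un_ones: "zeros \<union> ones = P"
  by (auto simp: zeros_def ones_def P_eq)

lemma edge_incomparable:
  assumes "edge w i j" "j \<le> N"
  shows "(g i, g j) \<notin> r" "(g j, g i) \<notin> r"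
  using assms rel[of i j] rel[of j i] by (auto simp: edge_def)

lemma last_zero:
  obtains i where "i \<le> m" "\<not> w i" "\<And>k. i < k \<Longrightarrow> k \<le> m \<Longrightarrow> w k"
proof -
  let ?S = "{k. k \<le> m \<and> \<not> w k}"
  have fin: "finite ?S" "?S \<noteq> {}" using w_0 by auto
  show ?thesis
  proof (rule that[of "Max ?S"])
    show "Max ?S \<le> m" "\<not> w (Max ?S)" using Max_in[OF fin] by auto
    show "w k" if "Max ?S < k" "k \<le> m" for k
    proof (rule ccontr)
      assume "\<not> w k"
      then have "k \<le> Max ?S" using Max_ge[OF fin(1), of k] that by simp
      then show False using that by simp
    qed
  qed
qed

lemma first_one:
  assumes "m < N"
  obtains j where "m < j" "j \<le> N" "w j" "\<And>k. m < k \<Longrightarrow> k < j \<Longrightarrow> \<not> w k"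
proof -
  let ?j = "LEAST j. m < j \<and> w j"
  have N: "m < N \<and> w N" using assms w_N by simp
  show ?thesis
  proof (rule that[of ?j])
    show "m < ?j" "w ?j" using LeastI[of "\<lambda>j. m < j \<and> w j", OF N] by auto
    show "?j \<le> N" using Least_le[of "\<lambda>j. m < j \<and> w j", OF N] .
    show "\<not> w k" if "m < k" "k < ?j" for k using not_less_Least[OF that(2)] that(1) by simp
  qed
qed

lemma N_pos: "0 < N" using w_0 w_N by (cases N) auto

text \<open>The ends of an edge lie in different chains. The induction follows the listing: the last
  zero \<open>i\<close> up to \<open>m\<close> and the first one \<open>j\<close> after
  \<open>m\<close> form an edge, which puts \<open>g j\<close> into \<open>D\<close>; if
  \<open>Suc m\<close> is a zero, its edge to \<open>j\<close> then puts it into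
  \<open>C\<close>.\<close>

lemma cover_unique_oriented:
  assumes C: "C \<in> Chains r" and D: "D \<in> Chains r" and CD: "C \<union> D = P" and g0: "g 0 \<in> C"
  shows "C = zeros \<and> D = ones"
proof -
  have zero_one: "g j \<in> D \<and> g j \<notin> C" if "edge w i j" "j \<le> N" "g i \<in> C" for i j
    using edge_incomparable[OF that(1,2)] that g_in[of j] C CD unfolding Chains_def by blast
  have one_zero: "g i \<in> C \<and> g i \<notin> D" if "edge w i j" "j \<le> N" "g j \<in> D" for i j
    using edge_incomparable[OF that(1,2)] that g_in[of i] D CD unfolding Chains_def edge_def by force
  have right: "\<forall>k\<le>m. (if w k then g k \<in> D \<and> g k \<notin> C else g k \<in> C \<and> g k \<notin> D)" if "m \<le> N" for m
    using that
  proof (induction m)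
    case 0
    obtain j where j: "0 < j" "j \<le> N" "w j" "\<And>k. 0 < k \<Longrightarrow> k < j \<Longrightarrow> \<not> w k"
      using first_one[OF N_pos] by blast
    then have "edge w 0 j" using w_0 by (auto simp: edge_def)
    then have "g 0 \<in> C \<and> g 0 \<notin> D" using zero_one one_zero j(2) g0 by blast
    then show ?case using w_0 by simp
  next
    case (Suc m)
    obtain i where i: "i \<le> m" "\<not> w i" "\<And>k. i < k \<Longrightarrow> k \<le> m \<Longrightarrow> w k"
      using last_zero[of m] by auto
    obtain j where j: "m < j" "j \<le> N" "w j" "\<And>k. m < k \<Longrightarrow> k < j \<Longrightarrow> \<not> w k"
      using first_one[of m] Suc.prems by auto
    have "edge w i j" using i j unfolding edge_def
      by (meson le_less_trans not_le order.strict_trans)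
    moreover have "g i \<in> C" using Suc i by auto
    ultimately have jD: "g j \<in> D \<and> g j \<notin> C" using zero_one j(2) by blast
    have "if w (Suc m) then g (Suc m) \<in> D \<and> g (Suc m) \<notin> C else g (Suc m) \<in> C \<and> g (Suc m) \<notin> D"
    proof (cases "w (Suc m)")
      case True
      then have "j = Suc m" using j by (metis Suc_lessI lessI)
      then show ?thesis using True jD by simp
    next
      case False
      have "j \<noteq> Suc m" using False j by blast
      then have "edge w (Suc m) j" using False j by (auto simp: edge_def)
      then show ?thesis using one_zero j(2) jD False by simp
    qed
    moreover have "\<forall>k\<le>m. (if w k then g k \<in> D \<and> g k \<notin> C else g k \<in> C \<and> g k \<notin> D)"
      using Suc by simp
    ultimately show ?case by (auto simp: le_Suc_eq)
  qed
  have "zeros \<subseteq> C - D" "ones \<subseteq> D - C" using right[of N] by (auto simp: zeros_def ones_def)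
  with CD zeros_Un_ones show ?thesis by blast
qed

lemma covers: "two_chain_covers P r = {{zeros, ones}}"
proof
  show "{{zeros, ones}} \<subseteq> two_chain_covers P r"
    using zeros_chain ones_chain zeros_Un_ones unfolding two_chain_covers_def by blast
  show "two_chain_covers P r \<subseteq> {{zeros, ones}}"
  proof
    fix X assume "X \<in> two_chain_covers P r"
    then obtain C D where X: "X = {C, D}" and CD: "C \<in> Chains r" "D \<in> Chains r" "C \<union> D = P"
      unfolding two_chain_covers_def by blast
    have "g 0 \<in> C \<or> g 0 \<in> D" using CD(3) g_in[of 0] by blast
    then have "C = zeros \<and> D = ones \<or> D = zeros \<and> C = ones"
      using cover_unique_oriented CD by (metis sup_commute)
    then show "X \<in> {{zeros, ones}}" using X by blast
  qed
qed

text \<open>For maximality, a proper refinement must compare the ends of some edge. That edge is a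
  bridge, so the two sides it separates become comparable across, and exchanging the chains on one
  side gives a second cover.\<close>

lemma two_chain: "two_chain P r"
  unfolding two_chain_def
proof (intro conjI allI impI)
  show "finite P" by (simp add: P_eq)
  show "partial_order_on P r" by (rule partial_order)
  show "\<exists>!C. C \<in> two_chain_covers P r" by (simp add: covers)
  fix s assume s: "partial_order_on P s \<and> r \<subset> s"
  then have sP: "s \<subseteq> P \<times> P" and "antisym s"
    by (auto simp: partial_order_on_def preorder_on_def)
  obtain x y where xy: "(x, y) \<in> s" "(x, y) \<notin> r" using s by auto
  then obtain u v where uv: "u \<le> N" "v \<le> N" "x = g u" "y = g v" using sP P_eq by blast
  have "u \<noteq> v" using xy uv by (auto simp: rel)
  define i where "i = min u v"
  define j where "j = max u v"
  \<comment> \<open>A new pair running against the listing is also an edge: otherwise its reverse is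
    in \<open>r\<close>, against antisymmetry of \<open>s\<close>.\<close>
  have "\<not> v < u \<or> edge w v u"
  proof (rule ccontr)
    assume "\<not> ?thesis"
    then have "(y, x) \<in> r" using uv by (simp add: rel)
    then show False using xy \<open>antisym s\<close> s \<open>u \<noteq> v\<close> uv
      by (metis antisymD g_eq psubsetD)
  qed
  moreover have "\<not> u < v \<or> edge w u v" using xy(2) uv by (auto simp: rel)
  ultimately have e: "edge w i j" "j \<le> N" "i \<le> N"
    using \<open>u \<noteq> v\<close> uv by (auto simp: i_def j_def min_def max_def)
  have comp: "(g i, g j) \<in> s \<or> (g j, g i) \<in> s"
    using xy uv by (auto simp: i_def j_def min_def max_def)
  obtain S where S: "i \<in> S \<longleftrightarrow> j \<notin> S"
    "\<And>k l. edge w k l \<Longrightarrow> (k \<in> S \<longleftrightarrow> l \<notin> S) \<Longrightarrow> k = i \<and> l = j"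
    using edge_bridge[OF e(1)] by blast
  have chains: "zeros \<in> Chains s" "ones \<in> Chains s"
    using zeros_chain ones_chain s unfolding Chains_def by blast+
  have mem: "g k \<in> g ` (S \<inter> {..N}) \<longleftrightarrow> k \<in> S" if "k \<le> N" for k
    using that by (auto simp: g_eq)
  have cut: "(a, b) \<in> s \<or> (b, a) \<in> s"
    if ab: "a \<in> P" "b \<in> P" "a \<in> g ` (S \<inter> {..N})" "b \<notin> g ` (S \<inter> {..N})" for a b
  proof -
    obtain k l where kl: "k \<le> N" "l \<le> N" "a = g k" "b = g l" using ab P_eq by auto
    then have "k \<in> S" "l \<notin> S" using ab mem by auto
    show ?thesis
    proof (cases "edge w k l \<or> edge w l k")
      case True
      then have "{k, l} = {i, j}" using S(2) \<open>k \<in> S\<close> \<open>l \<notin> S\<close> by blast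
      then show ?thesis using comp kl by (auto simp: doubleton_eq_iff)
    next
      case False
      then have "(a, b) \<in> r \<or> (b, a) \<in> r" using kl by (auto simp: rel)
      then show ?thesis using s by blast
    qed
  qed
  show "\<exists>C D. C \<in> two_chain_covers P s \<and> D \<in> two_chain_covers P s \<and> C \<noteq> D"
  proof (cases "i \<in> S")
    case True
    then show ?thesis
      using two_covers_if_cut[of zeros s ones P "g i" "g ` (S \<inter> {..N})" "g j"]
        chains zeros_Un_ones g_in mem e S(1) cut by blast
  next
    case False
    then show ?thesis
      using two_covers_if_cut[of zeros s ones P "g j" "g ` (S \<inter> {..N})" "g i"]
        chains zeros_Un_ones g_in mem e S(1) cut by blast
  qed
qed

section \<open>Recovering the word from the poset\<close>

lemma down_eq: "k \<le> N \<Longrightarrow> down P r (g k) = card {i. i < k \<and> \<not> edge w i k}"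
proof -
  assume k: "k \<le> N"
  have "{y \<in> P. y \<noteq> g k \<and> (y, g k) \<in> r} = g ` {i. i < k \<and> \<not> edge w i k}"
    using k by (auto simp: P_eq rel g_eq)
  moreover have "inj_on g {i. i < k \<and> \<not> edge w i k}"
    using k by (auto simp: inj_on_def g_eq)
  ultimately show ?thesis by (simp add: down_def card_image)
qed

lemma down_zero: "k \<le> N \<Longrightarrow> \<not> w k \<Longrightarrow> down P r (g k) = k"
  by (simp add: down_eq edge_def)

lemma down_first_one:
  assumes "k \<le> N" "w k" "\<And>i. i < k \<Longrightarrow> \<not> w i"
  shows "down P r (g k) = 0"
proof -
  have "edge w i k" if "i < k" for i using that assms by (auto simp: edge_def)
  then show ?thesis by (simp add: down_eq assms)
qed

text \<open>The indices joined to \<open>k\<close> are the zeros after \<open>q\<close> and the last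
  zero \<open>z\<close> before \<open>q\<close>; an earlier zero would have the ascent from
  \<open>z\<close> to \<open>q\<close> inside. What remains is \<open>{..q} - {z}\<close>, with
  \<open>q\<close> elements.\<close>

lemma down_next_one:
  assumes k: "k \<le> N" "w k" and q: "q < k" "w q" "\<And>i. q < i \<Longrightarrow> i < k \<Longrightarrow> \<not> w i"
  shows "down P r (g k) = q"
proof -
  obtain z where z: "z \<le> q" "\<not> w z" "\<And>i. z < i \<Longrightarrow> i \<le> q \<Longrightarrow> w i"
    using last_zero[of q] by auto
  have "{i. i < k \<and> \<not> edge w i k} = {..q} - {z}"
  proof (intro equalityI subsetI)
    fix i assume i: "i \<in> {i. i < k \<and> \<not> edge w i k}"
    have "edge w z k" using z k q unfolding edge_def
      by (metis le_less_trans not_le order.strict_trans)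
    then have "i \<noteq> z" using i by auto
    moreover have "i \<le> q"
    proof (rule ccontr)
      assume "\<not> i \<le> q"
      then have "edge w i k" using i q k by (auto simp: edge_def)
      then show False using i by simp
    qed
    ultimately show "i \<in> {..q} - {z}" by simp
  next
    fix i assume i: "i \<in> {..q} - {z}"
    have "\<not> edge w i k"
    proof
      assume e: "edge w i k"
      then have "i < z" using i z by (metis DiffE atMost_iff edge_def insertI1 linorder_neqE_nat)
      then show False using e z q unfolding edge_def by (metis le_neq_implies_less)
    qed
    then show "i \<in> {i. i < k \<and> \<not> edge w i k}" using i q by auto
  qed
  then show ?thesis using z k by (simp add: down_eq)
qed

text \<open>The value 0 occurs in both chains, at \<open>g 0\<close> and at the first one. Removing
  it gives the two image lemmas the same shape, so either chain can be matched with either.\<close>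

lemma down_image_zeros: "down P r ` zeros - {0} = {k. 0 < k \<and> k < N \<and> \<not> w k}"
proof -
  have "down P r ` zeros = {k. k \<le> N \<and> \<not> w k}"
    unfolding zeros_def image_image using down_zero by (auto simp: image_def)
  then show ?thesis using w_N by (auto simp: le_less)
qed

text \<open>After the first one, \<open>down\<close> sends each one to the position of the preceding
  one, so every position of a one except \<open>N\<close> is hit.\<close>

lemma down_image_ones: "down P r ` ones - {0} = {k. 0 < k \<and> k < N \<and> w k}"
proof (intro equalityI subsetI)
  fix q assume "q \<in> down P r ` ones - {0}"
  then obtain k where k: "k \<le> N" "w k" "q = down P r (g k)" "q \<noteq> 0"
    by (auto simp: ones_def)
  let ?S = "{i. i < k \<and> w i}"
  have fin: "finite ?S" by simp
  have ne: "?S \<noteq> {}" using down_first_one[of k] k by auto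
  have "Max ?S < k" "w (Max ?S)" using Max_in[OF fin ne] by auto
  moreover have "\<not> w i" if "Max ?S < i" "i < k" for i
  proof
    assume "w i"
    then have "i \<le> Max ?S" using Max_ge[OF fin, of i] that by simp
    then show False using that by simp
  qed
  ultimately have "q = Max ?S" unfolding k(3) by (rule down_next_one[OF k(1,2)])
  then have "w q" "q < k" using \<open>Max ?S < k\<close> \<open>w (Max ?S)\<close> by (simp_all del: Max_less_iff)
  then show "q \<in> {k. 0 < k \<and> k < N \<and> w k}" using k by simp
next
  fix q assume q: "q \<in> {k. 0 < k \<and> k < N \<and> w k}"
  then obtain k where k: "q < k" "k \<le> N" "w k" "\<And>i. q < i \<Longrightarrow> i < k \<Longrightarrow> \<not> w i"
    using first_one[of q] by auto
  then have "down P r (g k) = q" using down_next_one[of k q] q by blast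
  then show "q \<in> down P r ` ones - {0}" using q k by (force simp: ones_def)
qed

end

lemma word_poset_isomorphic:
  assumes "word_poset w N P r g" "word_poset w N Q s h"
  shows "poset_isomorphic P r Q s"
proof -
  interpret P: word_poset w N P r g by fact
  interpret Q: word_poset w N Q s h by fact
  let ?g = "inv_into {..N} g"
  have bij: "bij_betw (h \<circ> ?g) P Q"
    using bij_betw_trans[OF bij_betw_inv_into[OF P.bij] Q.bij] .
  have inv: "?g (g k) = k" if "k \<le> N" for k
    using bij_betw_inv_into_left[OF P.bij] that by simp
  have "(x, y) \<in> r \<longleftrightarrow> ((h \<circ> ?g) x, (h \<circ> ?g) y) \<in> s" if "x \<in> P" "y \<in> P" for x y
    using that by (auto simp: P.P_eq inv P.rel Q.rel)
  with bij show ?thesis unfolding poset_isomorphic_def by blast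
qed

lemma word_poset_transfer:
  assumes "word_poset w N P r g" "bij_betw f P Q" "s \<subseteq> Q \<times> Q"
    "\<And>x y. x \<in> P \<Longrightarrow> y \<in> P \<Longrightarrow> (x, y) \<in> r \<longleftrightarrow> (f x, f y) \<in> s"
  shows "word_poset w N Q s (f \<circ> g)"
proof -
  interpret word_poset w N P r g by fact
  show ?thesis
  proof
    show "bij_betw (f \<circ> g) {..N} Q" using bij assms(2) by (rule bij_betw_trans)
    show "((f \<circ> g) i, (f \<circ> g) j) \<in> s \<longleftrightarrow> i = j \<or> i < j \<and> \<not> edge w i j"
      if "i \<le> N" "j \<le> N" for i j
      using rel[OF that] assms(4)[of "g i" "g j"] that g_in by simp
  qed (use w_0 w_N assms in auto)
qed

text \<open>The unique cover matches the two colour classes up to a swap, and \<open>down\<close>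
  does not refer to the listing. The end letters agree in both words even when the inner ones are
  complementary.\<close>

lemma word_poset_word_unique:
  assumes "word_poset w N P r g" "word_poset w' N P r g'"
  shows "(\<forall>k. 0 < k \<and> k < N \<longrightarrow> w' k = w k) \<or> (\<forall>k. 0 < k \<and> k < N \<longrightarrow> w' k = (\<not> w k))"
proof -
  interpret A: word_poset w N P r g by fact
  interpret B: word_poset w' N P r g' by fact
  have "{A.zeros, A.ones} = {B.zeros, B.ones}" using A.covers B.covers by simp
  then consider "B.zeros = A.zeros" | "B.zeros = A.ones" by (auto simp: doubleton_eq_iff)
  then show ?thesis
  proof cases
    case 1
    then have "{k. 0 < k \<and> k < N \<and> \<not> w' k} = {k. 0 < k \<and> k < N \<and> \<not> w k}"
      using A.down_image_zeros B.down_image_zeros by simp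
    then show ?thesis by blast
  next
    case 2
    then have "{k. 0 < k \<and> k < N \<and> \<not> w' k} = {k. 0 < k \<and> k < N \<and> w k}"
      using A.down_image_ones B.down_image_zeros by simp
    then show ?thesis by blast
  qed
qed

section \<open>The poset of a binary sequence as a word poset\<close>

lemma length_seq_at: "length (seq_at a i) = length a + 1"
  by (auto simp: seq_at_def)

text \<open>For \<open>i = 0\<close> the inserted 0 falls off on the left, for
  \<open>i = length a + 1\<close> the inserted 1 falls off on the right; so one formula covers all
  cases of \<open>seq_at\<close>.\<close>

lemma nth_seq_at:
  assumes "i \<le> length a + 1" "k \<le> length a"
  shows "seq_at a i ! k =
    (if k + 1 < i then word a (k + 1) else if k + 1 = i then False
     else if k = i then True else word a k)"
proof -
  consider "i = 0" | "0 < i" "i \<le> length a" | "i = length a + 1" using assms by linarith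
  then show ?thesis
  proof cases
    case 1
    then show ?thesis using assms by (auto simp: seq_at_def word_def nth_Cons')
  next
    case 2
    then show ?thesis using assms
      by (auto simp: seq_at_def word_def nth_append nth_Cons' min_def) (cases a; simp)
  next
    case 3
    then show ?thesis using assms by (auto simp: seq_at_def word_def nth_append)
  qed
qed

lemma ex_adjacent_descent:
  assumes "p (i :: nat)" "\<not> p j" "i < j"
  shows "\<exists>k. i \<le> k \<and> k < j \<and> p k \<and> \<not> p (Suc k)"
proof (rule ccontr)
  assume none: "\<not> ?thesis"
  have "i \<le> k \<Longrightarrow> k \<le> j \<Longrightarrow> p k" for k
  proof (induction k rule: dec_induct)
    case base
    then show ?case using assms by blast
  next
    case (step n)
    then show ?case using none by (metis Suc_le_lessD less_imp_le_nat)
  qed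
  then show False using assms by simp
qed

text \<open>For \<open>k\<close> from \<open>i\<close> to \<open>j - 1\<close>, the entries to
  compare are letters \<open>k\<close> and \<open>k + 1\<close> of the word on \<open>i..j\<close>
  with its ends replaced by 1 and 0 (this is \<open>?p\<close>), which must descend somewhere. Hence
  only ascents decide whether the sequences are opposed.\<close>

lemma seq_at_descent:
  assumes ij: "i < j" "j \<le> length a + 1"
  shows "\<exists>k \<le> length a. seq_at a i ! k \<and> \<not> seq_at a j ! k"
proof -
  let ?p = "\<lambda>k. k = i \<or> (k < j \<and> word a k)"
  obtain k where k: "i \<le> k" "k < j" "?p k" "\<not> ?p (Suc k)"
    using ex_adjacent_descent[of ?p i j] ij by auto
  have "seq_at a i ! k" "\<not> seq_at a j ! k"
    using k ij by (auto simp: nth_seq_at)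
  then show ?thesis using k ij by (intro exI[of _ k]) auto
qed

text \<open>An ascent can occur only at \<open>i - 1\<close> (if letter \<open>i\<close> is 1), at
  \<open>j\<close> (if letter \<open>j\<close> is 0), or at an adjacent ascent of the word strictly
  between. For \<open>i = 0\<close> or \<open>j = length a + 1\<close> the outer position is
  missing, which the added end letters 0 and 1 of \<open>word a\<close> reflect.\<close>

lemma seq_at_ascent_iff:
  assumes ij: "i < j" "j \<le> length a + 1"
  shows "(\<exists>k \<le> length a. \<not> seq_at a i ! k \<and> seq_at a j ! k) \<longleftrightarrow> \<not> edge (word a) i j"
proof
  assume "\<exists>k \<le> length a. \<not> seq_at a i ! k \<and> seq_at a j ! k"
  then obtain k where k: "k \<le> length a" "\<not> seq_at a i ! k" "seq_at a j ! k" by blast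
  show "\<not> edge (word a) i j"
  proof
    assume e: "edge (word a) i j"
    consider "k + 1 < i" | "k + 1 = i" | "k = i" | "i < k" "k + 1 < j" | "i < k" "k + 1 = j"
      | "k = j" | "j < k" by linarith
    then show False
    proof cases
      case 4
      then have "\<not> word a k" "word a (k + 1)" using k ij by (auto simp: nth_seq_at)
      then show False using edge_no_ascent[OF e, of k "k + 1"] 4 by simp
    qed (use k ij e in \<open>auto simp: nth_seq_at edge_def\<close>)
  qed
next
  assume "\<not> edge (word a) i j"
  then consider "word a i" | "\<not> word a j" | "\<exists>k l. i < k \<and> k < l \<and> l < j \<and> \<not> word a k \<and> word a l"
    using ij by (auto simp: edge_def)
  then show "\<exists>k \<le> length a. \<not> seq_at a i ! k \<and> seq_at a j ! k"
  proof cases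
    case 1
    then have "0 < i" by (auto simp: word_def)
    then show ?thesis using 1 ij by (intro exI[of _ "i - 1"]) (auto simp: nth_seq_at)
  next
    case 2
    then have "j \<le> length a" by (auto simp: word_def)
    then show ?thesis using 2 ij by (intro exI[of _ j]) (auto simp: nth_seq_at)
  next
    case 3
    then obtain k l where kl: "i < k" "k < l" "l < j" "\<not> word a k" "word a l" by blast
    obtain m where "k \<le> m" "m < l" "\<not> word a m" "word a (Suc m)"
      using ex_adjacent_descent[of "\<lambda>k. \<not> word a k" k l] kl by auto
    then show ?thesis using kl ij by (intro exI[of _ m]) (auto simp: nth_seq_at)
  qed
qed

lemma seq_at_neq: "i < j \<Longrightarrow> j \<le> length a + 1 \<Longrightarrow> seq_at a i \<noteq> seq_at a j"
  using seq_at_descent by metis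

lemma seq_at_inj: "i \<le> length a + 1 \<Longrightarrow> j \<le> length a + 1 \<Longrightarrow> seq_at a i = seq_at a j \<longleftrightarrow> i = j"
  using seq_at_neq by (metis linorder_neqE_nat)

lemma opposed_seq_at:
  assumes "i < j" "j \<le> length a + 1"
  shows "opposed (seq_at a i) (seq_at a j) \<longleftrightarrow> \<not> edge (word a) i j"
  using seq_at_descent[OF assms] seq_at_ascent_iff[OF assms]
  by (auto simp: opposed_def length_seq_at less_Suc_eq_le)

lemma word_poset_pset: "word_poset (word a) (length a + 1) (pset a) (pord a) (seq_at a)"
proof
  show "\<not> word a 0" "word a (length a + 1)" by (auto simp: word_def)
  show "bij_betw (seq_at a) {..length a + 1} (pset a)"
    unfolding bij_betw_def pset_def by (auto simp: inj_on_def seq_at_inj)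
  show "pord a \<subseteq> pset a \<times> pset a" by (auto simp: pord_def)
  fix i j assume ij: "i \<le> length a + 1" "j \<le> length a + 1"
  then have "(seq_at a i, seq_at a j) \<in> pord a \<longleftrightarrow> i = j \<or> i < j \<and> opposed (seq_at a i) (seq_at a j)"
    by (auto simp: pord_def pset_def seq_at_inj simp del: One_nat_def)
  then show "(seq_at a i, seq_at a j) \<in> pord a \<longleftrightarrow> i = j \<or> i < j \<and> \<not> edge (word a) i j"
    using opposed_seq_at ij by auto
qed

section \<open>Every 2-chain is a word poset\<close>

lemma two_chain_imp_word_poset:
  assumes two: "two_chain P r" and card: "card P = n + 2"
  obtains a g where "length a = n" "word_poset (word a) (n + 1) P r g"
proof -
  have fin: "finite P" and po: "partial_order_on P r"
    and unique: "\<And>C D. C \<in> two_chain_covers P r \<Longrightarrow> D \<in> two_chain_covers P r \<Longrightarrow> C = D"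
    and maximal: "\<And>s. partial_order_on P s \<Longrightarrow> r \<subset> s \<Longrightarrow>
        \<exists>C D. C \<in> two_chain_covers P s \<and> D \<in> two_chain_covers P s \<and> C \<noteq> D"
    using two by (auto simp: two_chain_def)
  have rP: "r \<subseteq> P \<times> P" and "antisym r" "trans r" and refl: "\<And>x. x \<in> P \<Longrightarrow> (x, x) \<in> r"
    using po by (auto simp: partial_order_on_def preorder_on_def refl_on_def)
  have antisym: "x = y" if "(x, y) \<in> r" "(y, x) \<in> r" for x y
    using that \<open>antisym r\<close> by (blast dest: antisymD)
  have trans: "(x, z) \<in> r" if "(x, y) \<in> r" "(y, z) \<in> r" for x y z
    using that \<open>trans r\<close> by (blast dest: transD)
  obtain X where "X \<in> two_chain_covers P r" using two by (auto simp: two_chain_def)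
  then obtain A B where A: "A \<in> Chains r" and B: "B \<in> Chains r" and AB: "A \<union> B = P"
    by (auto simp: two_chain_covers_def)
  have disj: "A \<inter> B = {}"
    using two_covers_if_overlap[OF A B AB] unique by blast
  have compA: "(x, y) \<in> r \<or> (y, x) \<in> r" if "x \<in> A" "y \<in> A" for x y
    using A that by (auto simp: Chains_def)
  have compB: "(x, y) \<in> r \<or> (y, x) \<in> r" if "x \<in> B" "y \<in> B" for x y
    using B that by (auto simp: Chains_def)

  define lt where "lt x y \<longleftrightarrow> x \<in> P \<and> y \<in> P \<and> x \<noteq> y \<and> ((x, y) \<in> r \<or> (y, x) \<notin> r \<and> x \<in> A)" for x y
  \<comment> \<open>An incomparable step goes from \<open>A\<close> to \<open>B\<close>, so two of
    them cannot be consecutive; one combined with a step in \<open>r\<close> is settled by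
    transitivity and comparability inside \<open>B\<close>.\<close>
  have lt_trans: "lt x z" if "lt x y" "lt y z" for x y z
  proof -
    have P: "x \<in> P" "y \<in> P" "z \<in> P" "x \<noteq> y" "y \<noteq> z" using that by (auto simp: lt_def)
    have xy: "(x, y) \<in> r \<or> (x, y) \<notin> r \<and> (y, x) \<notin> r \<and> x \<in> A \<and> y \<in> B"
      using that(1) P AB compA by (auto simp: lt_def)
    have yz: "(y, z) \<in> r \<or> (y, z) \<notin> r \<and> (z, y) \<notin> r \<and> y \<in> A \<and> z \<in> B"
      using that(2) P AB compA by (auto simp: lt_def)
    have "x \<noteq> z" using xy yz antisym P disj by blast
    moreover have "(x, z) \<in> r \<or> (z, x) \<notin> r \<and> x \<in> A"
      using xy yz trans AB disj P compB by blast
    ultimately show ?thesis using P by (simp add: lt_def)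
  qed
  have lt_irrefl: "\<not> lt x x" for x by (simp add: lt_def)
  have lt_total: "lt x y \<or> lt y x" if "x \<in> P" "y \<in> P" "x \<noteq> y" for x y
    using that AB compB[of x y] unfolding lt_def by blast

  define f where "f x = card {y. lt y x}" for x
  have fin_lt: "finite {y. lt y x}" for x
    using fin by (rule rev_finite_subset) (auto simp: lt_def)
  have f_mono: "f x < f y" if "lt x y" for x y
    unfolding f_def using that lt_trans lt_irrefl by (intro psubset_card_mono fin_lt) blast
  have f_less_iff: "f x < f y \<longleftrightarrow> lt x y" if "x \<in> P" "y \<in> P" for x y
    using that f_mono lt_total by (metis less_asym less_irrefl)
  have f_inj: "inj_on f P" by (metis f_mono inj_onI less_irrefl lt_total)
  have "f x \<le> n + 1" if "x \<in> P" for x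
  proof -
    have "f x < card P" unfolding f_def
      using that lt_irrefl fin by (intro psubset_card_mono) (auto simp: lt_def)
    then show ?thesis using card by simp
  qed
  then have "f ` P = {..n + 1}"
    using card card_image[OF f_inj] by (intro card_subset_eq) auto
  then have f_bij: "bij_betw f P {..n + 1}" using f_inj by (simp add: bij_betw_def)
  define g where "g = inv_into P f"
  have g_bij: "bij_betw g {..n + 1} P" unfolding g_def by (rule bij_betw_inv_into[OF f_bij])
  have fg: "f (g k) = k" "g k \<in> P" if "k \<le> n + 1" for k
    using that f_bij g_bij by (auto simp: g_def bij_betw_inv_into_right bij_betw_def)
  have gf: "g (f x) = x" "f x \<le> n + 1" if "x \<in> P" for x
    using that f_bij by (auto simp: g_def bij_betw_inv_into_left bij_betw_def)

  \<comment> \<open>Otherwise ranks up to \<open>m\<close> and ranks above \<open>m\<close> are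
    comparable across, and \<open>two_covers_if_cut\<close> contradicts uniqueness.\<close>
  have crossing: "\<exists>u v. u \<in> A \<and> v \<in> B \<and> (u, v) \<notin> r \<and> f u \<le> m \<and> m < f v" if m: "m < n + 1" for m
  proof (rule ccontr)
    assume none: "\<not> ?thesis"
    have "(u, v) \<in> r \<or> (v, u) \<in> r" if "u \<in> P" "v \<in> P" "u \<in> {x. f x \<le> m}" "v \<notin> {x. f x \<le> m}" for u v
    proof -
      have "f u < f v" using that by simp
      then have "lt u v" using that f_less_iff by blast
      then have "(u, v) \<in> r \<or> u \<in> A \<and> v \<in> B"
        using AB compA[of u v] by (auto simp: lt_def)
      moreover have "f u \<le> m" "m < f v" using that by auto
      ultimately show ?thesis using none by blast
    qed
    then have "\<exists>C D. C \<in> two_chain_covers P r \<and> D \<in> two_chain_covers P r \<and> C \<noteq> D"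
      using two_covers_if_cut[OF A B AB, of "g 0" "{x. f x \<le> m}" "g (n + 1)"] fg m by simp
    then show False using unique by blast
  qed

  define a where "a = map (\<lambda>k. g (Suc k) \<in> B) [0..<n]"
  have len: "length a = n" by (simp add: a_def)
  have word_a: "word a k \<longleftrightarrow> g k \<in> B" if k: "k \<le> n + 1" for k
  proof -
    consider "k = 0" | "0 < k" "k \<le> n" | "k = n + 1" using k by linarith
    then show ?thesis
    proof cases
      case 1
      \<comment> \<open>The crossings at 0 and at \<open>n\<close> yield the end letters: the first
        element is in \<open>A\<close>, the last in \<open>B\<close>.\<close>
      obtain u where "u \<in> A" "f u \<le> 0" using crossing[of 0] by auto
      then have "g 0 \<in> A" using gf[of u] AB by auto
      then show ?thesis using 1 disj by (auto simp: word_def)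
    next
      case 2
      then show ?thesis using len by (simp add: word_def a_def)
    next
      case 3
      obtain v where "v \<in> B" "n < f v" using crossing[of n] by auto
      then have "g (n + 1) \<in> B" using gf[of v] AB by (metis Suc_eq_plus1 UnCI Suc_leI le_antisym)
      then show ?thesis using 3 len by (simp add: word_def)
    qed
  qed
  have word_f: "word a (f x) \<longleftrightarrow> x \<in> B" if "x \<in> P" for x
    using word_a gf that by simp
  have chain_le: "(x, y) \<in> r" if "f x \<le> f y" "x \<in> P" "y \<in> P" "x \<in> B \<longleftrightarrow> y \<in> B" for x y
  proof (cases "x = y")
    case False
    then have "(x, y) \<in> r \<or> (y, x) \<in> r" using compA compB that AB by blast
    moreover have "\<not> lt y x" using that f_mono by (meson not_le)
    ultimately show ?thesis using False that by (auto simp: lt_def)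
  qed (use that refl in simp)

  define s where "s = {(x, y). x \<in> P \<and> y \<in> P \<and> (x = y \<or> f x < f y \<and> \<not> edge (word a) (f x) (f y))}"
  have wp: "word_poset (word a) (n + 1) P s g"
  proof
    show "\<not> word a 0" "word a (n + 1)" using len by (auto simp: word_def)
    show "bij_betw g {..n + 1} P" by (rule g_bij)
    show "s \<subseteq> P \<times> P" by (auto simp: s_def)
    show "(g i, g j) \<in> s \<longleftrightarrow> i = j \<or> i < j \<and> \<not> edge (word a) i j" if "i \<le> n + 1" "j \<le> n + 1" for i j
      using fg[OF that(1)] fg[OF that(2)] by (auto simp: s_def)
  qed
  have "r \<subseteq> s"
  proof (rule subrelI)
    fix x y assume xy: "(x, y) \<in> r"
    then have P: "x \<in> P" "y \<in> P" using rP by auto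
    have "\<not> edge (word a) (f x) (f y)"
    proof
      assume e: "edge (word a) (f x) (f y)"
      \<comment> \<open>A pair \<open>u\<close>, \<open>v\<close> crossing this cut has
        \<open>f u <= f x\<close> and \<open>f y <= f v\<close>, with \<open>u\<close>,
        \<open>x\<close> in \<open>A\<close> and \<open>y\<close>, \<open>v\<close> in
        \<open>B\<close>. So \<open>u\<close>, \<open>x\<close>, \<open>y\<close>, \<open>v\<close>
        increase in \<open>r\<close>, against the choice of \<open>u\<close> and
        \<open>v\<close>.\<close>
      obtain m where m: "f x \<le> m" "m < f y" "\<And>k. k \<le> m \<Longrightarrow> \<not> word a k \<Longrightarrow> k \<le> f x"
        "\<And>l. m < l \<Longrightarrow> word a l \<Longrightarrow> f y \<le> l"
        using edge_cut[OF e] by blast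
      have "m < n + 1" using m(2) gf[OF P(2)] by simp
      then obtain u v where uv: "u \<in> A" "v \<in> B" "(u, v) \<notin> r" "f u \<le> m" "m < f v"
        using crossing by blast
      have uvP: "u \<in> P" "v \<in> P" "u \<notin> B" using uv AB disj by auto
      have "x \<notin> B" "y \<in> B" using e word_f P by (auto simp: edge_def)
      have "f u \<le> f x" "f y \<le> f v" using m(3,4) uv word_f uvP by auto
      then have "(u, x) \<in> r" "(y, v) \<in> r"
        using chain_le P uvP uv \<open>x \<notin> B\<close> \<open>y \<in> B\<close> by blast+
      then show False using trans xy uv(3) by blast
    qed
    moreover have "x = y \<or> f x < f y" using xy P f_mono by (auto simp: lt_def)
    ultimately show "(x, y) \<in> s" using P by (auto simp: s_def)
  qed
  \<comment> \<open>The order \<open>s\<close> has only one cover, so it cannot properly refine the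
    maximal \<open>r\<close>.\<close>
  moreover have "\<not> r \<subset> s"
    using maximal[of s] word_poset.partial_order[OF wp] word_poset.covers[OF wp] by auto
  ultimately have "s = r" by blast
  then show ?thesis using that len wp by blast
qed

section \<open>Isomorphic sequence posets and conclusion\<close>

lemma pset_isomorphic_imp:
  assumes iso: "poset_isomorphic (pset a) (pord a) (pset b) (pord b)"
  shows "b = a \<or> b = bar a"
proof -
  interpret A: word_poset "word a" "length a + 1" "pset a" "pord a" "seq_at a"
    by (rule word_poset_pset)
  interpret B: word_poset "word b" "length b + 1" "pset b" "pord b" "seq_at b"
    by (rule word_poset_pset)
  obtain f where f: "bij_betw f (pset a) (pset b)"
    "\<And>x y. x \<in> pset a \<Longrightarrow> y \<in> pset a \<Longrightarrow> (x, y) \<in> pord a \<longleftrightarrow> (f x, f y) \<in> pord b"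
    using iso unfolding poset_isomorphic_def by blast
  have len: "length a = length b"
    using bij_betw_same_card[OF A.bij] bij_betw_same_card[OF B.bij] bij_betw_same_card[OF f(1)] by simp
  \<comment> \<open>Transporting the listing of \<open>pset a\<close> along \<open>f\<close> makes
    both words describe the same poset.\<close>
  have "word_poset (word a) (length b + 1) (pset b) (pord b) (f \<circ> seq_at a)"
    using word_poset_transfer[OF A.word_poset_axioms f(1) B.r_subset f(2)] len by simp
  from word_poset_word_unique[OF this B.word_poset_axioms] show ?thesis
  proof
    assume *: "\<forall>k. 0 < k \<and> k < length b + 1 \<longrightarrow> word b k = word a k"
    have "b ! i = a ! i" if "i < length b" for i
      using *[rule_format, of "Suc i"] that len by (simp add: word_def)
    then show ?thesis using len by (simp add: nth_equalityI)
  next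
    assume *: "\<forall>k. 0 < k \<and> k < length b + 1 \<longrightarrow> word b k = (\<not> word a k)"
    have "b ! i = (\<not> a ! i)" if "i < length b" for i
      using *[rule_format, of "Suc i"] that len by (simp add: word_def)
    then show ?thesis using len by (simp add: nth_equalityI bar_def)
  qed
qed

theorem theorem4p8:
  fixes n :: nat
  shows "(\<forall>a. length a = n \<longrightarrow> two_chain (pset a) (pord a)) \<and>
    (\<forall>(P :: 'a set) r. card P = n + 2 \<and> two_chain P r \<longrightarrow>
       (\<exists>a. poset_isomorphic P r (pset a) (pord a))) \<and>
    (\<forall>a b. poset_isomorphic (pset a) (pord a) (pset b) (pord b) \<longrightarrow>
       b = a \<or> b = bar a)"
proof (intro conjI allI impI)
  show "two_chain (pset a) (pord a)" for a
    using word_poset_pset by (rule word_poset.two_chain)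
  show "\<exists>a. poset_isomorphic P r (pset a) (pord a)"
    if "card P = n + 2 \<and> two_chain P r" for P :: "'a set" and r
    using that two_chain_imp_word_poset word_poset_isomorphic word_poset_pset by metis
  show "b = a \<or> b = bar a" if "poset_isomorphic (pset a) (pord a) (pset b) (pord b)" for a b
    using that by (rule pset_isomorphic_imp)
qed

end
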